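(* For $N\ge5$ let $W_N$ be the (unweighted) wheel graph on $N$ nodes and let $q=q(N)$ be its spectral degree exponent. Then $q=2+o(1)$ for $N\to\infty$.
   Context: The wheel graph $W_N$ on $N$ nodes consists of a cycle on $N-1$ nodes together with one hub node adjacent to all nodes of the cycle; thus $N-1$ nodes have degree $3$ and one node has degree $N-1$. Spectral degree exponent (SDE): for a finite simple undirected non-regular graph with $n$ nodes, degrees $d_1,\dots,d_n$ and spectral radius $\lambda_1$ (the largest eigenvalue of the adjacency matrix), the SDE is the solution $q$ of $$\lambda_1=\left(\frac1n\sum_{i=1}^n d_i^{\,q}\right)^{1/q}.$$ It is a known fact that this solution exists, is unique and lies in $[2,\infty]$, where for $q=\infty$ the right-hand side is understood as its limit, the maximum degree. *)

theory Defs
  imports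
    Complex_Main
    "HOL-Library.Extended_Real"
    "Graph_Theory.Pair_Digraph"
    "Jordan_Normal_Form.Spectral_Radius"
begin

text \<open>
  A finite simple undirected graph is a \<open>pair_graph\<close>: a finite loop-free digraph with a symmetric
  set of arcs, each undirected edge being represented by its two orientations. In such a graph the
  degree of a vertex is its out-degree. To index matrices by vertices, the vertex set of a graph
  with n nodes is taken to be \<open>{..<n}\<close>.
\<close>

definition degree_of :: "nat pair_pre_digraph \<Rightarrow> nat \<Rightarrow> nat" where
  "degree_of G v = out_degree (with_proj G) v"

definition adjacency_matrix :: "nat pair_pre_digraph \<Rightarrow> real mat" where
  "adjacency_matrix G =
     mat (card (pverts G)) (card (pverts G)) (\<lambda>(i, j). if (i, j) \<in> parcs G then 1 else 0)"

text \<open>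
  The largest eigenvalue over the reals; the adjacency matrix of an undirected graph is real
  symmetric, so this ranges over its whole spectrum.
\<close>

definition largest_eigenvalue :: "nat pair_pre_digraph \<Rightarrow> real" where
  "largest_eigenvalue G = Max (spectrum (adjacency_matrix G))"

text \<open>
  The right-hand side of the equation for the spectral degree exponent. It is only used for
  \<open>0 < q\<close>, including \<open>q = \<infinity>\<close>, where it is the limit of the finite power means. (At negative q
  the powers of a degree 0 are undefined, at q = 0 so is the exponent 1/q.)
\<close>

definition degree_power_mean :: "nat pair_pre_digraph \<Rightarrow> ereal \<Rightarrow> real" where
  "degree_power_mean G q =
     (if q = \<infinity> then real (Max (degree_of G ` pverts G))
      else ((\<Sum>v\<in>pverts G. real (degree_of G v) powr real_of_ereal q) / real (card (pverts G)))
             powr (1 / real_of_ereal q))"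

definition spectral_degree_exponent :: "nat pair_pre_digraph \<Rightarrow> ereal" where
  "spectral_degree_exponent G =
     (THE q. 0 < q \<and> largest_eigenvalue G = degree_power_mean G q)"

text \<open>
  The wheel on N nodes, intended for \<open>N \<ge> 4\<close>: the cycle consists of the nodes \<open>0, \<dots>, N - 2\<close>
  with the successor taken modulo \<open>N - 1\<close>, and the hub is the node \<open>N - 1\<close>.
\<close>

definition wheel_graph :: "nat \<Rightarrow> nat pair_pre_digraph" where
  "wheel_graph N =
     \<lparr> pverts = {..<N},
       parcs = {(i, j). i < N - 1 \<and> j < N - 1 \<and>
                        (j = Suc i mod (N - 1) \<or> i = Suc j mod (N - 1))}
             \<union> {(i, N - 1) | i. i < N - 1}
             \<union> {(N - 1, i) | i. i < N - 1} \<rparr>"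

lemma pair_graph_wheel_graph:
  assumes "N \<ge> 4"
  shows "pair_graph (wheel_graph N)"
proof
  show "finite (pverts (wheel_graph N))" by (simp add: wheel_graph_def)
  have "parcs (wheel_graph N) \<subseteq> {..<N} \<times> {..<N}"
    using assms by (auto simp: wheel_graph_def mod_Suc split: if_splits)
  then show "finite (parcs (wheel_graph N))" by (rule finite_subset) simp
  show "fst e \<in> pverts (wheel_graph N)" "snd e \<in> pverts (wheel_graph N)"
    if "e \<in> parcs (wheel_graph N)" for e
    using that assms by (auto simp: wheel_graph_def mod_Suc split: if_splits)
  show "fst e \<noteq> snd e" if "e \<in> parcs (wheel_graph N)" for e
    using that assms by (auto simp: wheel_graph_def mod_Suc split: if_splits)
  show "symmetric (with_proj (wheel_graph N))"
    by (auto simp: symmetric_def wheel_graph_def intro!: symI)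
qed

lemma degree_of_wheel_graph:
  assumes "N \<ge> 4" "i < N"
  shows "degree_of (wheel_graph N) i = (if i = N - 1 then N - 1 else 3)"
proof -
  have *: "out_arcs (with_proj (wheel_graph N)) i
             = Pair i ` {j. (i, j) \<in> parcs (wheel_graph N)}"
    by (auto simp: out_arcs_def)
  have deg: "degree_of (wheel_graph N) i = card {j. (i, j) \<in> parcs (wheel_graph N)}"
    unfolding degree_of_def out_degree_def * by (rule card_image) (simp add: inj_on_def)
  show ?thesis
  proof (cases "i = N - 1")
    case True
    then have "{j. (i, j) \<in> parcs (wheel_graph N)} = {..<N - 1}"
      by (auto simp: wheel_graph_def)
    with True deg show ?thesis by simp
  next
    case False
    with assms have i: "i < N - 1" by simp
    define s where "s = (if Suc i = N - 1 then 0 else Suc i)"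
    define p where "p = (if i = 0 then N - 2 else i - 1)"
    have "{j. (i, j) \<in> parcs (wheel_graph N)} = {s, p, N - 1}"
      using i assms(1)
      by (auto simp: wheel_graph_def s_def p_def mod_Suc split: if_splits)
    moreover have "s \<noteq> p" "s \<noteq> N - 1" "p \<noteq> N - 1"
      using i assms(1) by (auto simp: s_def p_def split: if_splits)
    ultimately show ?thesis using False deg by simp
  qed
qed

end

theory Submission
  imports Defs "HOL-Real_Asymp.Real_Asymp"
begin

text \<open>
  The vector with entry 1 on the rim and \<open>\<surd>N - 1\<close> at the hub is a positive eigenvector of the
  wheel for \<open>\<lambda> = 1 + \<surd>N\<close>, so \<open>\<lambda>\<close> is the largest eigenvalue. For finite q the defining equation
  becomes \<open>f q = 1\<close>, where \<open>f q = ((N - 1) (3 / \<lambda>)\<^sup>q + ((N - 1) / \<lambda>)\<^sup>q) / N\<close>. Since \<open>f 0 = 1\<close> and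
  the derivative of a sum of two exponentials has at most one zero, Rolle's theorem leaves at
  most one positive solution. For every \<open>\<epsilon> > 0\<close> and all large N one has \<open>f 2 < 1 < f (2 + \<epsilon>)\<close>,
  so this solution lies between 2 and \<open>2 + \<epsilon>\<close>.
\<close>

text \<open>A comparison of Perron type: any eigenvector \<open>v\<close> is bounded entrywise by a
  multiple \<open>r * x\<close> of the positive eigenvector, with equality at some index. Reading
  the eigenvalue equation of \<open>v\<close> in that row gives \<open>m \<le> l\<close>.\<close>

lemma Max_spectrum_eqI_positive_eigenvector:
  fixes A :: "real mat"
  assumes A: "A \<in> carrier_mat n n" and nonneg: "\<And>i j. i < n \<Longrightarrow> j < n \<Longrightarrow> 0 \<le> A $$ (i, j)"
    and "0 < n" and pos: "\<And>i. i < n \<Longrightarrow> 0 < x i"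
    and eig: "\<And>i. i < n \<Longrightarrow> (\<Sum>j<n. A $$ (i, j) * x j) = l * x i"
  shows "Max (spectrum A) = l"
proof (rule Max_eqI)
  show "finite (spectrum A)" using card_finite_spectrum(1)[OF A] .
  have "eigenvector A (vec n x) l"
    unfolding eigenvector_def
  proof (intro conjI)
    show "vec n x \<in> carrier_vec (dim_row A)" using A by auto
    have "vec n x $ 0 \<noteq> 0" using pos[of 0] \<open>0 < n\<close> by simp
    then show "vec n x \<noteq> 0\<^sub>v (dim_row A)" using A \<open>0 < n\<close> by (metis carrier_matD(1) index_zero_vec(1))
    show "A *\<^sub>v vec n x = l \<cdot>\<^sub>v vec n x"
      using A eig by (intro eq_vecI) (auto simp: scalar_prod_def atLeast0LessThan)
  qed
  then show "l \<in> spectrum A" by (auto simp: spectrum_def eigenvalue_def)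
next
  fix m assume "m \<in> spectrum A"
  then obtain v where v: "v \<in> carrier_vec n" "v \<noteq> 0\<^sub>v n" "A *\<^sub>v v = m \<cdot>\<^sub>v v"
    using A by (auto simp: spectrum_def eigenvalue_def eigenvector_def)
  have mv: "(\<Sum>j<n. A $$ (i, j) * v $ j) = m * v $ i" if "i < n" for i
    using arg_cong[OF v(3), of "\<lambda>w. w $ i"] that A v(1)
    by (auto simp: scalar_prod_def atLeast0LessThan)
  \<comment> \<open>The least factor with \<open>\<bar>v $ j\<bar> \<le> r * x j\<close> for all
    \<open>j\<close>; the maximising index \<open>i\<close> turns this into an equality.\<close>
  define r where "r = Max ((\<lambda>i. \<bar>v $ i\<bar> / x i) ` {..<n})"
  have "r \<in> (\<lambda>i. \<bar>v $ i\<bar> / x i) ` {..<n}"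
    unfolding r_def using \<open>0 < n\<close> by (intro Max_in) auto
  then obtain i where i: "i < n" "r = \<bar>v $ i\<bar> / x i" by auto
  have r: "\<bar>v $ j\<bar> \<le> r * x j" if "j < n" for j
  proof -
    have "\<bar>v $ j\<bar> / x j \<le> r" unfolding r_def using that by (intro Max_ge) auto
    then show ?thesis using pos[OF that] by (simp add: field_simps)
  qed
  obtain k where k: "k < n" "v $ k \<noteq> 0"
    using v(1,2) by (metis carrier_vecD eq_vecI index_zero_vec)
  then have "0 < r * x k" using r[of k] by linarith
  then have "0 < r" using pos[OF k(1)] by (simp add: zero_less_mult_iff)
  have "m * (r * x i) \<le> \<bar>m * v $ i\<bar>"
    using i pos[OF i(1)] by (simp add: abs_mult mult_right_mono)
  also have "\<dots> \<le> (\<Sum>j<n. \<bar>A $$ (i, j) * v $ j\<bar>)"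
    unfolding mv[OF i(1), symmetric] by (rule sum_abs)
  also have "\<dots> \<le> (\<Sum>j<n. r * (A $$ (i, j) * x j))"
    using nonneg[OF i(1)] r
    by (intro sum_mono) (auto simp: abs_mult mult.left_commute[of r] intro!: mult_left_mono)
  also have "\<dots> = l * (r * x i)" by (simp flip: sum_distrib_left add: eig[OF i(1)])
  finally show "m \<le> l" using \<open>0 < r\<close> pos[OF i(1)] by (simp add: mult_le_cancel_right)
qed

lemma degree_of_eq_card: "degree_of G i = card {j. (i, j) \<in> parcs G}"
proof -
  have "out_arcs (with_proj G) i = Pair i ` {j. (i, j) \<in> parcs G}"
    by (auto simp: out_arcs_def)
  then show ?thesis by (simp add: degree_of_def out_degree_def card_image inj_on_def)
qed

text \<open>If the hub has entry \<open>h\<close> and the rim entry 1, the rim rows demand \<lambda>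
  = 2 + h and the hub row N - 1 = \<lambda> h. The positive root of h (h + 2) = N - 1 is
  \<open>h = sqrt N - 1\<close>.\<close>

lemma largest_eigenvalue_wheel_graph:
  assumes "N \<ge> 4"
  shows "largest_eigenvalue (wheel_graph N) = 1 + sqrt N"
  unfolding largest_eigenvalue_def
proof (rule Max_spectrum_eqI_positive_eigenvector)
  let ?G = "wheel_graph N"
  let ?x = "\<lambda>i. if i = N - 1 then sqrt N - 1 else 1 :: real"
  show "adjacency_matrix ?G \<in> carrier_mat N N"
    by (simp add: adjacency_matrix_def wheel_graph_def)
  show "0 \<le> adjacency_matrix ?G $$ (i, j)" if "i < N" "j < N" for i j
    using that by (simp add: adjacency_matrix_def wheel_graph_def)
  show "0 < N" using assms by simp
  show "0 < ?x i" if "i < N" for i using assms by simp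
  show "(\<Sum>j<N. adjacency_matrix ?G $$ (i, j) * ?x j) = (1 + sqrt N) * ?x i" if "i < N" for i
  proof -
    let ?S = "{j. (i, j) \<in> parcs ?G}"
    have S: "?S \<subseteq> {..<N}"
      using assms by (auto simp: wheel_graph_def mod_Suc split: if_splits)
    then have fin: "finite ?S" by (rule finite_subset) simp
    have "(\<Sum>j<N. adjacency_matrix ?G $$ (i, j) * ?x j) = (\<Sum>j<N. if j \<in> ?S then ?x j else 0)"
      using that by (intro sum.cong) (auto simp: adjacency_matrix_def wheel_graph_def)
    also have "\<dots> = sum ?x ?S"
      using S by (simp add: sum.inter_restrict[symmetric] Int_absorb1 del: mem_Collect_eq)
    \<comment> \<open>Writing the vector as the constant 1 plus a correction at the hub reduces each
      row sum to a degree, so the neighbours need not be listed again.\<close>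
    also have "\<dots> = (\<Sum>j\<in>?S. 1 + (if j = N - 1 then sqrt N - 2 else 0))"
      by (intro sum.cong) auto
    also have "\<dots> = real (degree_of ?G i) + (if N - 1 \<in> ?S then sqrt N - 2 else 0)"
      using fin by (simp add: sum.distrib degree_of_eq_card del: mem_Collect_eq)
    also have "N - 1 \<in> ?S \<longleftrightarrow> i \<noteq> N - 1"
      using that by (auto simp: wheel_graph_def)
    also have "real (degree_of ?G i) + (if i \<noteq> N - 1 then sqrt N - 2 else 0) = (1 + sqrt N) * ?x i"
      using assms that by (auto simp: degree_of_wheel_graph of_nat_diff algebra_simps)
    finally show ?thesis .
  qed
qed

lemma degree_power_mean_wheel_graph:
  assumes "N \<ge> 4"
  shows "degree_power_mean (wheel_graph N) (ereal p) =
    (((real N - 1) * 3 powr p + (real N - 1) powr p) / N) powr (1 / p)"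
proof -
  have "{..<N} = insert (N - 1) {..<N - 1}" using assms by auto
  then have "(\<Sum>v<N. real (degree_of (wheel_graph N) v) powr p) =
      real (degree_of (wheel_graph N) (N - 1)) powr p
      + (\<Sum>v<N - 1. real (degree_of (wheel_graph N) v) powr p)" by simp
  also have "\<dots> = (real N - 1) powr p + (real N - 1) * 3 powr p"
    using assms by (simp add: degree_of_wheel_graph of_nat_diff)
  finally show ?thesis
    using assms by (simp add: degree_power_mean_def wheel_graph_def add.commute)
qed

lemma degree_power_mean_wheel_graph_infinity:
  assumes "N \<ge> 4"
  shows "degree_power_mean (wheel_graph N) \<infinity> = real N - 1"
proof -
  have "Max (degree_of (wheel_graph N) ` {..<N}) = N - 1"
    using assms by (intro Max_eqI) (auto simp: degree_of_wheel_graph image_iff intro!: bexI[of _ "N - 1"])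
  then show ?thesis using assms by (simp add: degree_power_mean_def wheel_graph_def of_nat_diff)
qed

lemma eq_powr_inverse_iff:
  fixes l s p :: real
  assumes "0 < l" "0 < s" "p \<noteq> 0"
  shows "l = s powr (1 / p) \<longleftrightarrow> s = l powr p"
  using assms by (auto simp: powr_powr)

text \<open>The equation \<open>a + b = c\<close> says that 0 is already a solution. Two distinct
  positive ones would make three, and Rolle would give two distinct zeros of the derivative.\<close>

lemma exp_sum_unique_solution:
  fixes a b u v p q c :: real
  assumes nz: "a \<noteq> 0" "u \<noteq> 0" "u \<noteq> v"
    and eq: "a + b = c" "a * exp (u * p) + b * exp (v * p) = c" "a * exp (u * q) + b * exp (v * q) = c"
    and "0 < p" "0 < q"
  shows "p = q"
proof -
  have False if pq: "0 < p" "p < q"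
      "a * exp (u * p) + b * exp (v * p) = c" "a * exp (u * q) + b * exp (v * q) = c" for p q
  proof -
    let ?f = "\<lambda>t. a * exp (u * t) + b * exp (v * t)"
    have d: "(?f has_real_derivative a * u * exp (u * t) + b * v * exp (v * t)) (at t)" for t
      by (auto intro!: derivative_eq_intros)
    have rolle: "\<exists>z. s < z \<and> z < t \<and> a * u * exp (u * z) + b * v * exp (v * z) = 0"
      if "s < t" "?f s = ?f t" for s t
    proof -
      have "\<exists>z. s < z \<and> z < t \<and> (?f has_real_derivative 0) (at z)"
      proof (rule Rolle[OF that])
        show "continuous_on {s..t} ?f" by (intro continuous_intros)
        show "?f differentiable (at x)" for x using d real_differentiable_def by blast
      qed
      then show ?thesis using DERIV_unique d by blast
    qed
    obtain y where y: "y < p" "a * u * exp (u * y) + b * v * exp (v * y) = 0"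
      using rolle[of 0 p] pq eq(1) by auto
    obtain z where z: "p < z" "a * u * exp (u * z) + b * v * exp (v * z) = 0"
      using rolle[of p q] pq by auto
    \<comment> \<open>Division by \<open>exp (v * t)\<close> leaves a single exponential, which is
      injective in \<open>t\<close> because \<open>u \<noteq> v\<close>.\<close>
    have "a * u * exp ((u - v) * t) = - (b * v)"
      if "a * u * exp (u * t) + b * v * exp (v * t) = 0" for t
      using that by (simp add: left_diff_distrib exp_diff field_simps eq_neg_iff_add_eq_0)
    from this[OF y(2)] this[OF z(2)] have "a * u * exp ((u - v) * y) = a * u * exp ((u - v) * z)"
      by simp
    then have "y = z" using nz by simp
    then show False using y z by simp
  qed
  from this[of p q] this[of q p] assms show ?thesis by argo
qed

text \<open>This reduces the definite description to exhibiting one positive real solution: a second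
  finite one contradicts the uniqueness for exponential sums, and \<infinity> is excluded
  separately.\<close>

lemma spectral_degree_exponent_wheel_graph_eqI:
  assumes N: "N \<ge> 5" and "0 < p"
    and p: "((real N - 1) * 3 powr p + (real N - 1) powr p) / N = (1 + sqrt N) powr p"
  shows "spectral_degree_exponent (wheel_graph N) = ereal p"
  unfolding spectral_degree_exponent_def
proof (rule the_equality)
  define l where "l = 1 + sqrt N"
  \<comment> \<open>Here \<open>N \<ge> 5\<close> enters. At \<open>N = 4\<close> the wheel is the
    regular graph K4, with \<open>l = 3\<close>, and every exponent solves the equation.\<close>
  have "2 < sqrt N" using N by (simp add: real_less_rsqrt)
  then have l: "3 < l" by (simp add: l_def)
  have sol: "largest_eigenvalue (wheel_graph N) = degree_power_mean (wheel_graph N) (ereal t) \<longleftrightarrow>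
      ((real N - 1) * 3 powr t + (real N - 1) powr t) / N = l powr t" if "0 < t" for t
  proof -
    have "0 < ((real N - 1) * 3 powr t + (real N - 1) powr t) / N"
      using N by (intro divide_pos_pos add_pos_pos mult_pos_pos) auto
    then show ?thesis
      using N l that unfolding l_def
      by (simp add: largest_eigenvalue_wheel_graph degree_power_mean_wheel_graph eq_powr_inverse_iff)
  qed
  show "0 < ereal p \<and> largest_eigenvalue (wheel_graph N) = degree_power_mean (wheel_graph N) (ereal p)"
    using sol[OF \<open>0 < p\<close>] \<open>0 < p\<close> p by (simp add: l_def)
  \<comment> \<open>Dividing by \<open>l powr t\<close> puts the equation in the form of
    \<open>exp_sum_unique_solution\<close>, with \<open>c = N\<close> as the value at
    \<open>t = 0\<close>.\<close>
  have exp_form: "(real N - 1) * exp (ln (3 / l) * t) + 1 * exp (ln ((real N - 1) / l) * t) = N"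
    if "((real N - 1) * 3 powr t + (real N - 1) powr t) / N = l powr t" for t
  proof -
    have "x powr t / l powr t = exp (ln (x / l) * t)" if "0 < x" for x
      using that l by (simp add: powr_def ln_div exp_diff algebra_simps)
    from this[of 3] this[of "real N - 1"]
    have "(real N - 1) * exp (ln (3 / l) * t) + 1 * exp (ln ((real N - 1) / l) * t)
        = ((real N - 1) * 3 powr t + (real N - 1) powr t) / l powr t"
      using N by (simp add: add_divide_distrib flip: times_divide_eq_right)
    also have "\<dots> = N"
      using that N l by (simp add: nonzero_divide_eq_eq nonzero_eq_divide_eq mult.commute)
    finally show ?thesis .
  qed
  fix q assume q: "0 < q \<and> largest_eigenvalue (wheel_graph N) = degree_power_mean (wheel_graph N) q"
  show "q = ereal p"
  proof (cases q)
    case (real t)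
    have "p = t"
    proof (rule exp_sum_unique_solution)
      show "real N - 1 \<noteq> 0" "real N - 1 + 1 = real N" using N by auto
      show "ln (3 / l) \<noteq> 0" using l by simp
      show "ln (3 / l) \<noteq> ln ((real N - 1) / l)" using l N by simp
      show "0 < p" "0 < t" using \<open>0 < p\<close> q real by auto
      show "(real N - 1) * exp (ln (3 / l) * p) + 1 * exp (ln ((real N - 1) / l) * p) = N"
        using p by (intro exp_form) (simp add: l_def)
      show "(real N - 1) * exp (ln (3 / l) * t) + 1 * exp (ln ((real N - 1) / l) * t) = N"
        using q real sol[of t] by (intro exp_form) auto
    qed
    with real show ?thesis by simp
  next
    case PInf
    then have "1 + sqrt N = real N - 1"
      using q N by (simp add: largest_eigenvalue_wheel_graph degree_power_mean_wheel_graph_infinity)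
    \<comment> \<open>With s = \<open>sqrt N\<close>, equality of the spectral radius and the
      maximum degree reads s^2 - s - 2 = 0, whose only nonnegative root is 2.\<close>
    moreover have "real N = sqrt N * sqrt N" by simp
    ultimately have "(sqrt N - 2) * (sqrt N + 1) = 0" by (simp add: algebra_simps)
    with \<open>2 < sqrt N\<close> show ?thesis by simp
  qed (use q in auto)
qed

lemma eventually_spectral_degree_exponent_wheel_graph:
  assumes "0 < e"
  shows "\<forall>\<^sub>F N in sequentially. 2 \<le> spectral_degree_exponent (wheel_graph N) \<and>
    spectral_degree_exponent (wheel_graph N) \<le> ereal (2 + e)"
proof -
  \<comment> \<open>At exponent 2 the left side is N + 7 - 8/N and the right side N + 2
    \<open>sqrt N\<close> + 1, so the term 2 \<open>sqrt N\<close> decides.\<close>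
  have "\<forall>\<^sub>F N in sequentially.
      ((real N - 1) * 3 ^ 2 + (real N - 1) ^ 2) / N \<le> (1 + sqrt N) ^ 2"
    by real_asymp
  \<comment> \<open>At exponent 2 + e the hub term alone suffices: it has order N^(1 + e), against
    N^(1 + e/2) on the left.\<close>
  moreover have "\<forall>\<^sub>F N in sequentially.
      (1 + sqrt (real N)) powr (2 + e) \<le> (real N - 1) powr (2 + e) / N"
    using assms by real_asymp
  ultimately show ?thesis
    using eventually_ge_at_top[of 5]
  proof eventually_elim
    case (elim N)
    let ?f = "\<lambda>t. ((real N - 1) * 3 powr t + (real N - 1) powr t) / N - (1 + sqrt N) powr t"
    have "0 < 1 + sqrt N" using real_sqrt_ge_zero[of N] by linarith
    \<comment> \<open>The two asymptotic inequalities are the sign conditions on \<open>?f\<close>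
      at the ends of the interval.\<close>
    have "\<exists>t\<ge>2. t \<le> 2 + e \<and> ?f t = 0"
    proof (rule IVT')
      show "?f 2 \<le> 0" using elim \<open>0 < 1 + sqrt N\<close> by simp
      have "(real N - 1) powr (2 + e) / N
          \<le> ((real N - 1) * 3 powr (2 + e) + (real N - 1) powr (2 + e)) / N"
        using elim by (intro divide_right_mono) auto
      then show "0 \<le> ?f (2 + e)" using elim by linarith
      show "2 \<le> 2 + e" using assms by simp
      show "continuous_on {2..2 + e} ?f"
        using elim \<open>0 < 1 + sqrt N\<close> by (intro continuous_intros) auto
    qed
    then obtain t where t: "2 \<le> t" "t \<le> 2 + e" "?f t = 0" by auto
    then have "spectral_degree_exponent (wheel_graph N) = ereal t"
      using elim by (intro spectral_degree_exponent_wheel_graph_eqI) auto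
    then show ?case using t by simp
  qed
qed

theorem theorem6:
  fixes q :: "nat \<Rightarrow> ereal"
  assumes "\<And>N. N \<ge> 5 \<Longrightarrow> q N = spectral_degree_exponent (wheel_graph N)"
  shows "q \<longlonglongrightarrow> 2"
proof (rule order_tendstoI)
  have bounds: "\<forall>\<^sub>F N in sequentially. 2 \<le> q N \<and> q N \<le> ereal (2 + e)" if "0 < e" for e :: real
    using eventually_spectral_degree_exponent_wheel_graph[OF that] eventually_ge_at_top[of 5]
    by eventually_elim (simp add: assms)
  show "\<forall>\<^sub>F N in sequentially. a < q N" if "a < 2" for a
    using bounds[of 1, simplified] by eventually_elim (use that in auto)
  show "\<forall>\<^sub>F N in sequentially. q N < a" if "2 < a" for a
  proof -
    \<comment> \<open>As \<open>a\<close> may be \<infinity>, a real \<open>r\<close> strictly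
      between 2 and \<open>a\<close> is chosen; the bounds are then used with
      \<open>e = r - 2\<close>.\<close>
    obtain r where r: "2 < ereal r" "ereal r < a" using ereal_dense2 \<open>2 < a\<close> by blast
    then have "0 < r - 2" by simp
    from bounds[OF this] show ?thesis by eventually_elim (use r in auto)
  qed
qed

end
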